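(* Let $[c,d]$ be a finite closed interval, let $m$ be a positive integer, and suppose that $\Delta_1$ and $\Delta_2$ are two partitions of $[c,d]$. Then $$S_m(\Delta_1)+S_m(\Delta_2)=S_m(\Delta_1\cup\Delta_2),$$ where the left-hand side is the sum of vector subspaces, $\{f+g : f\in S_m(\Delta_1),\ g\in S_m(\Delta_2)\}$.
   Context: A partition of a finite closed interval $[c,d]$ ($c<d$) is a finite set of points $\Delta=\{x_i\}_{i=0}^{N+1}$, $N\in\mathbb{N}=\{1,2,\dots\}$, such that $c=x_0<x_1<\cdots<x_N<x_{N+1}=d$. Its associated subintervals are $I_i=[x_i,x_{i+1})$ for $i=0,\dots,N-1$ and $I_N=[x_N,x_{N+1}]$. The union $\Delta_1\cup\Delta_2$ of two partitions of $[c,d]$ (as sets of points) is again a partition of $[c,d]$. For $k\in\mathbb{N}\cup\{0\}$, $\Pi_k$ denotes the space of (real) polynomials of degree at most $k$. For a positive integer $m$, the spline space of order $m$ is $$S_m(\Delta)=\{f\in C^{m-2}[c,d] : f|_{I_i}\in\Pi_{m-1},\ i=0,\dots,N\},$$ where $f|_{I_i}$ is the restriction of $f$ to $I_i$. For $m=1$ the condition $f\in C^{-1}[c,d]$ is void, i.e. $f$ is any real function on $[c,d]$ whose restriction to each $I_i$ is constant. *)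

theory Defs
  imports "HOL-Analysis.Analysis" "HOL-Computational_Algebra.Polynomial"
begin

definition is_partition :: "real \<Rightarrow> real \<Rightarrow> real set \<Rightarrow> bool" where
  "is_partition c d \<Delta> \<longleftrightarrow>
     (\<exists>(N :: nat) (x :: nat \<Rightarrow> real). N \<ge> 1 \<and> x 0 = c \<and> x (N + 1) = d \<and> (\<forall>i\<le>N. x i < x (i + 1)) \<and>
            \<Delta> = x ` {0..N + 1})"

(* The increasing enumeration x_0 < ... < x_{N+1} is determined by the point set;
   it is recovered here by sorting, see knot_eq below. *)

definition knot :: "real set \<Rightarrow> nat \<Rightarrow> real" where
  "knot \<Delta> i = sorted_list_of_set \<Delta> ! i"

definition num_inner :: "real set \<Rightarrow> nat" where
  "num_inner \<Delta> = card \<Delta> - 2"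

definition subinterval :: "real set \<Rightarrow> nat \<Rightarrow> real set" where
  "subinterval \<Delta> i =
     (if i < num_inner \<Delta> then {knot \<Delta> i ..< knot \<Delta> (i + 1)}
      else {knot \<Delta> i .. knot \<Delta> (i + 1)})"

lemma
  fixes N :: nat and x :: "nat \<Rightarrow> real"
  assumes "\<And>i. i \<le> N \<Longrightarrow> x i < x (i + 1)"
    and "\<Delta> = x ` {0..N + 1}"
  shows num_inner_eq: "num_inner \<Delta> = N"
    and knot_eq: "i \<le> N + 1 \<Longrightarrow> knot \<Delta> i = x i"
proof -
  have less: "x i < x j" if "i < j" "j \<le> N + 1" for i j
    using that
  proof (induction j)
    case (Suc j)
    have "x j < x (Suc j)" using assms(1)[of j] Suc.prems by simp
    moreover have "x i \<le> x j" using Suc by (cases "i = j") auto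
    ultimately show ?case by simp
  qed simp
  have sorted: "sorted_wrt (<) (map x [0..<N + 2])"
    unfolding sorted_wrt_iff_nth_less by (auto simp: less simp del: upt_Suc)
  have set: "set (map x [0..<N + 2]) = \<Delta>"
    using assms(2) by (auto simp: image_iff less_Suc_eq_le simp del: upt_Suc)
  have list: "sorted_list_of_set \<Delta> = map x [0..<N + 2]"
    using sorted set by (metis sorted_list_of_set.idem_if_sorted_distinct strict_sorted_iff)
  have "length (sorted_list_of_set \<Delta>) = N + 2" using list by simp
  then show "num_inner \<Delta> = N" by (simp add: num_inner_def)
  show "knot \<Delta> i = x i" if "i \<le> N + 1"
    using that by (simp add: knot_def list del: upt_Suc)
qed

(* C^k on an interval, with one-sided derivatives at the end points. *)

primrec C_diff_on :: "nat \<Rightarrow> real set \<Rightarrow> (real \<Rightarrow> real) \<Rightarrow> bool" where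
  "C_diff_on 0 S f \<longleftrightarrow> continuous_on S f"
| "C_diff_on (Suc k) S f \<longleftrightarrow>
     (\<exists>f'. (\<forall>x\<in>S. (f has_real_derivative f' x) (at x within S)) \<and> C_diff_on k S f')"

(* A real function on [c,d] is represented by its extension by zero to the whole line.
   The smoothness condition is void for m = 1. *)

definition spline_space :: "nat \<Rightarrow> real \<Rightarrow> real \<Rightarrow> real set \<Rightarrow> (real \<Rightarrow> real) set" where
  "spline_space m c d \<Delta> =
     {f. (\<forall>x. x \<notin> {c..d} \<longrightarrow> f x = 0) \<and>
         (m \<ge> 2 \<longrightarrow> C_diff_on (m - 2) {c..d} f) \<and>
         (\<forall>i\<le>num_inner \<Delta>. \<exists>p :: real poly. degree p \<le> m - 1 \<and>
            (\<forall>x\<in>subinterval \<Delta> i. f x = poly p x))}"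

end

(* A spline of order n + 1 is a polynomial plus a combination of the truncated powers
   (t - \<xi>)_+^n attached to the inner knots \<xi>: neighbouring polynomial pieces agree to order n at
   their common knot, so they differ by a multiple of (t - \<xi>)^n. In this representation, adding
   two splines and splitting one spline both amount to bookkeeping with the sets of inner knots. *)

theory Submission
  imports Defs
begin

section \<open>Smoothness on an interval\<close>

text \<open>Derivatives are taken within \<open>S\<close>, so the same \<open>f'\<close> serves both
  functions. Smoothness of a function extended by zero can thus be read off a formula valid on [c,d]
  only.\<close>

lemma C_diff_on_cong:
  assumes "\<And>x. x \<in> S \<Longrightarrow> f x = g x" and "C_diff_on k S f"
  shows "C_diff_on k S g"
proof (cases k)
  case 0
  then show ?thesis using assms by (auto cong: continuous_on_cong)
next
  case (Suc l)
  then obtain f' where f': "\<And>x. x \<in> S \<Longrightarrow> (f has_real_derivative f' x) (at x within S)"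
    and "C_diff_on l S f'"
    using assms(2) by auto
  moreover have "(g has_real_derivative f' x) (at x within S)" if "x \<in> S" for x
    using f'[OF that] assms(1) that
    by (metis (no_types, lifting) has_field_derivative_transform_within zero_less_one)
  ultimately show ?thesis using Suc by auto
qed

lemma C_diff_on_add:
  assumes "C_diff_on k S f" and "C_diff_on k S g"
  shows "C_diff_on k S (\<lambda>x. f x + g x)"
  using assms
proof (induction k arbitrary: f g)
  case 0
  then show ?case by (auto intro: continuous_intros)
next
  case (Suc k)
  obtain f' where
    "\<And>x. x \<in> S \<Longrightarrow> (f has_real_derivative f' x) (at x within S)" "C_diff_on k S f'"
    using Suc.prems(1) by auto
  moreover obtain g' where
    "\<And>x. x \<in> S \<Longrightarrow> (g has_real_derivative g' x) (at x within S)" "C_diff_on k S g'"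
    using Suc.prems(2) by auto
  ultimately show ?case
    using Suc.IH[of f' g'] by (auto intro!: exI[of _ "\<lambda>x. f' x + g' x"] DERIV_add)
qed

lemma C_diff_on_cmult:
  assumes "C_diff_on k S f"
  shows "C_diff_on k S (\<lambda>x. a * f x)"
  using assms
proof (induction k arbitrary: f)
  case 0
  then show ?case by (auto intro: continuous_intros)
next
  case (Suc k)
  then obtain f' where
    "\<And>x. x \<in> S \<Longrightarrow> (f has_real_derivative f' x) (at x within S)" "C_diff_on k S f'"
    by auto
  then show ?case
    using Suc.IH[of f'] by (auto intro!: exI[of _ "\<lambda>x. a * f' x"] DERIV_cmult)
qed

lemma C_diff_on_poly: "C_diff_on k S (poly p)"
proof (induction k arbitrary: p)
  case 0
  then show ?case by (auto intro: continuous_intros)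
next
  case (Suc k)
  then show ?case
    by (auto intro!: exI[of _ "poly (pderiv p)"] poly_DERIV[THEN has_field_derivative_at_within])
qed

lemma C_diff_on_sum:
  assumes "\<And>i. i \<in> A \<Longrightarrow> C_diff_on k S (f i)"
  shows "C_diff_on k S (\<lambda>x. \<Sum>i\<in>A. f i x)"
proof -
  have zero: "C_diff_on k S (\<lambda>x. 0)"
    by (rule C_diff_on_cong[OF _ C_diff_on_poly[of k S 0]]) simp
  show ?thesis using assms
    by (induction A rule: infinite_finite_induct) (auto intro: zero C_diff_on_add)
qed

lemma C_diff_on_imp_continuous_on: "C_diff_on k S f \<Longrightarrow> continuous_on S f"
  by (cases k) (auto intro: DERIV_continuous simp: continuous_on_eq_continuous_within)

section \<open>Truncated powers\<close>

(* For n = 0 this is the right-continuous step function, matching the half-open subintervals. *)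

definition truncated_power :: "nat \<Rightarrow> real \<Rightarrow> real \<Rightarrow> real" where
  "truncated_power n \<xi> t = (if \<xi> \<le> t then (t - \<xi>) ^ n else 0)"

text \<open>For a positive exponent the two branches meet at \<xi>; as a power of a maximum the
  function is visibly continuous there.\<close>

lemma truncated_power_Suc: "truncated_power (Suc n) \<xi> t = max 0 (t - \<xi>) ^ Suc n"
  by (auto simp: truncated_power_def max_def)

lemma isCont_truncated_power: "isCont (truncated_power (Suc n) \<xi>) t"
  unfolding truncated_power_Suc[abs_def] by (intro continuous_intros)

text \<open>Away from \<xi> a single branch holds on an open half-line. The exponent is at least 2
  because exponent 1 leaves a corner at \<xi>.\<close>

lemma DERIV_truncated_power:
  "(truncated_power (Suc (Suc n)) \<xi> has_real_derivative
     of_nat (Suc (Suc n)) * truncated_power (Suc n) \<xi> t) (at t)"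
proof (cases t \<xi> rule: linorder_cases)
  case less
  have "((\<lambda>t. 0) has_real_derivative 0) (at t)" by simp
  then have "(truncated_power (Suc (Suc n)) \<xi> has_real_derivative 0) (at t)"
    by (rule has_field_derivative_transform_within_open[where S = "{..<\<xi>}"])
       (use less in \<open>auto simp: truncated_power_def\<close>)
  then show ?thesis using less by (simp add: truncated_power_def)
next
  case greater
  have "((\<lambda>t. (t - \<xi>) ^ Suc (Suc n)) has_real_derivative
      of_nat (Suc (Suc n)) * (t - \<xi>) ^ Suc n) (at t)"
    by (rule derivative_eq_intros refl | simp)+
  then have "(truncated_power (Suc (Suc n)) \<xi> has_real_derivative
      of_nat (Suc (Suc n)) * (t - \<xi>) ^ Suc n) (at t)"
    by (rule has_field_derivative_transform_within_open[where S = "{\<xi><..}"])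
       (use greater in \<open>auto simp: truncated_power_def\<close>)
  then show ?thesis using greater by (simp add: truncated_power_def)
next
  case equal
  \<comment> \<open>Caratheodory's criterion: the difference quotient at \<xi> extends to the
    truncated power of exponent one lower, which is continuous with value 0 at \<xi>.\<close>
  have "\<forall>z. truncated_power (Suc (Suc n)) \<xi> z - truncated_power (Suc (Suc n)) \<xi> \<xi> =
      truncated_power (Suc n) \<xi> z * (z - \<xi>)"
    by (auto simp: truncated_power_def)
  then have "(truncated_power (Suc (Suc n)) \<xi> has_real_derivative truncated_power (Suc n) \<xi> \<xi>)
      (at \<xi>)"
    using isCont_truncated_power[of \<xi> n \<xi>] by (auto simp: CARAT_DERIV)
  then show ?thesis using equal by (simp add: truncated_power_def)
qed

text \<open>Each differentiation lowers the exponent by one, so the k-th derivative is a multiple of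
  the power with exponent 1, which is still continuous.\<close>

lemma C_diff_on_truncated_power: "C_diff_on k S (truncated_power (Suc k) \<xi>)"
proof (induction k)
  case 0
  show ?case
    using isCont_truncated_power[of _ 0] by (simp add: continuous_at_imp_continuous_on)
next
  case (Suc k)
  show ?case
    unfolding C_diff_on.simps
    by (rule exI[of _ "\<lambda>t. of_nat (Suc (Suc k)) * truncated_power (Suc k) \<xi> t"])
       (intro conjI ballI C_diff_on_cmult Suc
          DERIV_truncated_power[THEN has_field_derivative_at_within])
qed

section \<open>Jumps at a knot\<close>

lemma poly_eq_of_pderiv_eq:
  fixes p q :: "real poly"
  assumes "pderiv p = pderiv q" and "poly p x = poly q x"
  shows "p = q"
proof -
  have "pderiv (p - q) = 0" using assms(1) by (simp add: pderiv_diff)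
  then have "degree (p - q) = 0" by (simp add: pderiv_eq_0_iff)
  then obtain a where "p - q = [:a:]" by (rule degree_eq_zeroE)
  moreover have "poly (p - q) x = 0" using assms(2) by simp
  ultimately show ?thesis by simp
qed

text \<open>Antiderivatives of both sides differ by a constant, and agreement at x makes that
  constant zero.\<close>

lemma jump_integrate:
  fixes p q :: "real poly"
  assumes "pderiv q = pderiv p + smult a ([:-x, 1:] ^ n)" and "poly p x = poly q x"
  shows "q = p + smult (a / of_nat (Suc n)) ([:-x, 1:] ^ Suc n)"
proof (rule poly_eq_of_pderiv_eq)
  show "pderiv q = pderiv (p + smult (a / of_nat (Suc n)) ([:-x, 1:] ^ Suc n))"
    unfolding assms(1) pderiv_add pderiv_smult pderiv_power_Suc
    by (simp add: pderiv_pCons del: of_nat_Suc)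
  show "poly q x = poly (p + smult (a / of_nat (Suc n)) ([:-x, 1:] ^ Suc n)) x"
    using assms(2) by simp
qed

text \<open>By continuity both values are one-sided limits of f at x. Agreement is asked only off x,
  so it does not matter which piece owns the knot.\<close>

lemma poly_eq_at_knot:
  fixes p q :: "real poly"
  assumes "continuous_on S f" and "a < x" "x < b" "{a<..<b} \<subseteq> S"
    and p: "\<And>t. a < t \<Longrightarrow> t < x \<Longrightarrow> f t = poly p t"
    and q: "\<And>t. x < t \<Longrightarrow> t < b \<Longrightarrow> f t = poly q t"
  shows "poly p x = poly q x"
proof -
  have "isCont f x"
    using assms(1-4) by (meson continuous_on_eq_continuous_at continuous_on_subset
      greaterThanLessThan_iff open_greaterThanLessThan)
  then have f: "(f \<longlongrightarrow> f x) (at_left x)" "(f \<longlongrightarrow> f x) (at_right x)"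
    by (auto simp: isCont_def filterlim_at_split)
  have poly: "(poly r \<longlongrightarrow> poly r x) (at x within T)" for r :: "real poly" and T
    by (intro tendsto_intros)
  have "(f \<longlongrightarrow> poly p x) (at_left x)"
    by (rule Lim_transform_eventually[OF poly])
       (use p assms(2) in \<open>auto simp: eventually_at_left_field\<close>)
  moreover have "(f \<longlongrightarrow> poly q x) (at_right x)"
    by (rule Lim_transform_eventually[OF poly])
       (use q assms(3) in \<open>auto simp: eventually_at_right_field\<close>)
  ultimately show ?thesis
    using f by (metis tendsto_unique trivial_limit_at_left_real trivial_limit_at_right_real)
qed

text \<open>Induction on k: differentiate f and both pieces, take the jump of the derivatives from
  the induction hypothesis, and integrate it using that the pieces agree at x.\<close>

lemma jump_at_knot:
  fixes p q :: "real poly"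
  assumes "C_diff_on k S f" and "a < x" "x < b" "{a<..<b} \<subseteq> S"
    and "\<And>t. a < t \<Longrightarrow> t < x \<Longrightarrow> f t = poly p t"
    and "\<And>t. x < t \<Longrightarrow> t < b \<Longrightarrow> f t = poly q t"
    and "degree p \<le> Suc k" "degree q \<le> Suc k"
  shows "\<exists>e. q = p + smult e ([:-x, 1:] ^ Suc k)"
  using assms
proof (induction k arbitrary: f p q)
  case 0
  \<comment> \<open>Linear pieces have constant derivatives, and a constant jump is a multiple of
    the zeroth power, ready for \<open>jump_integrate\<close>.\<close>
  then have "degree (q - p) \<le> 1" by (simp add: degree_diff_le)
  then have "degree (pderiv (q - p)) = 0" by (simp add: degree_pderiv)
  then obtain e where "pderiv (q - p) = [:e:]" by (rule degree_eq_zeroE)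
  then have "pderiv q = pderiv p + smult e ([:-x, 1:] ^ 0)"
    by (simp add: pderiv_diff algebra_simps)
  moreover have "poly p x = poly q x" using 0 by (intro poly_eq_at_knot[of S f a x b]) auto
  ultimately show ?case by (blast dest: jump_integrate)
next
  case (Suc k)
  obtain f' where f': "\<And>t. t \<in> S \<Longrightarrow> (f has_real_derivative f' t) (at t within S)"
    and "C_diff_on k S f'"
    using Suc.prems(1) by auto
  \<comment> \<open>On an open interval inside \<open>S\<close> the derivative within
    \<open>S\<close> is the ordinary one, so f' inherits polynomial pieces from f. The interval
    (u,v) is left free to serve both sides of x.\<close>
  have deriv: "f' t = poly (pderiv r) t"
    if "u < t" "t < v" "{u<..<v} \<subseteq> {a<..<b}" "\<And>t. u < t \<Longrightarrow> t < v \<Longrightarrow> f t = poly r t"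
    for u v t r
  proof -
    have sub: "{u<..<v} \<subseteq> S" using that(3) Suc.prems(4) by blast
    have "t \<in> S" using sub that(1,2) by auto
    from has_field_derivative_subset[OF f'[OF this] sub]
    have "(f has_real_derivative f' t) (at t)"
      using that(1,2) by (simp add: at_within_open[of t "{u<..<v}"])
    then have "(poly r has_real_derivative f' t) (at t)"
      by (rule has_field_derivative_transform_within_open[where S = "{u<..<v}"])
         (use that in auto)
    then show ?thesis using poly_DERIV by (rule DERIV_unique)
  qed
  have "\<exists>e. pderiv q = pderiv p + smult e ([:-x, 1:] ^ Suc k)"
  proof (rule Suc.IH)
    show "C_diff_on k S f'" by fact
    show "f' t = poly (pderiv p) t" if "a < t" "t < x" for t
      by (rule deriv[of a t x]) (use that Suc.prems in auto)
    show "f' t = poly (pderiv q) t" if "x < t" "t < b" for t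
      by (rule deriv[of x t b]) (use that Suc.prems in auto)
  qed (use Suc.prems in \<open>auto simp: degree_pderiv\<close>)
  moreover have "poly p x = poly q x"
    using Suc.prems C_diff_on_imp_continuous_on by (intro poly_eq_at_knot[of S f a x b]) blast+
  ultimately show ?case by (blast dest: jump_integrate)
qed

section \<open>The truncated power representation\<close>

lemma strict_mono_on_partition:
  fixes x :: "nat \<Rightarrow> real"
  assumes "\<And>i. i \<le> N \<Longrightarrow> x i < x (i + 1)"
  shows "strict_mono_on {0..N + 1} x"
proof (rule strict_mono_onI)
  show "x i < x j" if "i \<in> {0..N + 1}" "j \<in> {0..N + 1}" "i < j" for i j
    using that(3,2)
  proof (induction rule: strict_inc_induct)
    case (base i)
    then show ?case using assms[of i] by auto
  next
    case (step i)
    then show ?case using assms[of i] by auto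
  qed
qed

lemma subinterval_eq:
  fixes x :: "nat \<Rightarrow> real"
  assumes "\<And>i. i \<le> N \<Longrightarrow> x i < x (i + 1)" and "\<Delta> = x ` {0..N + 1}" and "i \<le> N"
  shows "subinterval \<Delta> i = (if i < N then {x i..<x (i + 1)} else {x i..x (i + 1)})"
proof -
  have "num_inner \<Delta> = N" using assms(1,2) by (rule num_inner_eq)
  moreover have "knot \<Delta> j = x j" if "j \<le> N + 1" for j
    using assms(1,2) that by (rule knot_eq)
  ultimately show ?thesis using assms(3) unfolding subinterval_def by simp
qed

text \<open>Without the enumeration, closure under unions becomes immediate. Sorting recovers the
  enumeration, and the inner point accounts for N \<ge> 1.\<close>

lemma is_partition_iff:
  "is_partition c d \<Delta> \<longleftrightarrow>
     finite \<Delta> \<and> c \<in> \<Delta> \<and> d \<in> \<Delta> \<and> \<Delta> \<subseteq> {c..d} \<and> (\<exists>\<xi>\<in>\<Delta>. c < \<xi> \<and> \<xi> < d)"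
proof
  assume "is_partition c d \<Delta>"
  then obtain N :: nat and x :: "nat \<Rightarrow> real" where N: "N \<ge> 1" and x: "x 0 = c" "x (N + 1) = d" "\<And>i. i \<le> N \<Longrightarrow> x i < x (i + 1)"
    and \<Delta>: "\<Delta> = x ` {0..N + 1}"
    unfolding is_partition_def by blast
  have mono: "strict_mono_on {0..N + 1} x"
    using strict_mono_on_partition x(3) .
  have "x 0 \<le> x i \<and> x i \<le> x (N + 1)" if "i \<le> N + 1" for i
    using that strict_mono_on_leD[OF mono, of 0 i] strict_mono_on_leD[OF mono, of i "N + 1"] by simp
  moreover have "x 0 < x 1" "x 1 < x (N + 1)"
    using N strict_mono_onD[OF mono, of 0 1] strict_mono_onD[OF mono, of 1 "N + 1"] by auto
  moreover have "c \<in> \<Delta>" "d \<in> \<Delta>" "x 1 \<in> \<Delta>"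
    unfolding \<Delta> x(1,2)[symmetric] by (intro imageI; simp)+
  ultimately show "finite \<Delta> \<and> c \<in> \<Delta> \<and> d \<in> \<Delta> \<and> \<Delta> \<subseteq> {c..d} \<and> (\<exists>\<xi>\<in>\<Delta>. c < \<xi> \<and> \<xi> < d)"
    unfolding x(1,2) using \<Delta> by (intro conjI bexI[of _ "x 1"]) auto
next
  assume *: "finite \<Delta> \<and> c \<in> \<Delta> \<and> d \<in> \<Delta> \<and> \<Delta> \<subseteq> {c..d} \<and> (\<exists>\<xi>\<in>\<Delta>. c < \<xi> \<and> \<xi> < d)"
  then obtain \<xi> where \<xi>: "\<xi> \<in> \<Delta>" "c < \<xi>" "\<xi> < d" by blast
  define xs where "xs = sorted_list_of_set \<Delta>"
  define N where "N = length xs - 2"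
  have xs: "set xs = \<Delta>" "sorted_wrt (<) xs" using * by (auto simp: xs_def)
  \<comment> \<open>Three distinct points make \<open>length xs - 2\<close> a genuine subtraction
    with a positive result.\<close>
  have "card {c, \<xi>, d} \<le> card \<Delta>" using * \<xi> by (intro card_mono) auto
  then have "length xs \<ge> 3" using \<xi> by (simp add: xs_def)
  then have len: "length xs = N + 2" "N \<ge> 1" by (auto simp: N_def)
  have less: "xs ! i < xs ! j" if "i < j" "j < N + 2" for i j
    using xs(2) that len by (simp add: sorted_wrt_iff_nth_less)
  have range: "c \<le> xs ! i" "xs ! i \<le> d" if "i < N + 2" for i
    using * xs(1) len(1) that nth_mem[of i xs] by auto
  have "c \<in> set xs" "d \<in> set xs" using * xs(1) by auto
  then obtain i j where ij: "i < N + 2" "xs ! i = c" "j < N + 2" "xs ! j = d"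
    unfolding in_set_conv_nth len(1) by blast
  \<comment> \<open>The positions of c and d are not known, but monotonicity bounds the first entry
    by c and the last from below by d; \<open>range\<close> gives the reverse inequalities.\<close>
  have "xs ! 0 \<le> c"
    using less[of 0 i] ij by (cases "i = 0") auto
  moreover have "d \<le> xs ! (N + 1)"
    using less[of j "N + 1"] ij by (cases "j = N + 1") auto
  ultimately have "xs ! 0 = c" "xs ! (N + 1) = d"
    using range[of 0] range[of "N + 1"] by auto
  moreover have "\<Delta> = (!) xs ` {0..N + 1}"
    unfolding xs(1)[symmetric] set_conv_nth by (auto simp: len(1))
  ultimately show "is_partition c d \<Delta>"
    unfolding is_partition_def using len(2) by (intro exI[of _ N] exI[of _ "(!) xs"]) (simp add: less)
qed

lemma is_partition_Un:
  "is_partition c d \<Delta>\<^sub>1 \<Longrightarrow> is_partition c d \<Delta>\<^sub>2 \<Longrightarrow> is_partition c d (\<Delta>\<^sub>1 \<union> \<Delta>\<^sub>2)"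
  by (auto simp: is_partition_iff)

text \<open>Start from the polynomial on the first subinterval. Crossing an inner knot adds a jump,
  and a truncated power is such a jump switched on from its knot onwards.\<close>

lemma spline_imp_truncated_powers:
  assumes part: "is_partition c d \<Delta>" and f: "f \<in> spline_space (Suc n) c d \<Delta>"
  shows "\<exists>p a. degree p \<le> n \<and>
    (\<forall>t\<in>{c..d}. f t = poly p t + (\<Sum>\<xi>\<in>\<Delta> - {c, d}. a \<xi> * truncated_power n \<xi> t))"
proof -
  obtain N :: nat and x :: "nat \<Rightarrow> real" where N: "N \<ge> 1" and x: "x 0 = c" "x (N + 1) = d" "\<And>i. i \<le> N \<Longrightarrow> x i < x (i + 1)"
    and \<Delta>: "\<Delta> = x ` {0..N + 1}"
    using part unfolding is_partition_def by blast
  have mono: "strict_mono_on {0..N + 1} x"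
    using strict_mono_on_partition x(3) .
  have le: "x i \<le> x j" if "i \<le> j" "j \<le> N + 1" for i j
    using that strict_mono_on_leD[OF mono, of i j] by simp
  have num: "num_inner \<Delta> = N" using x(3) \<Delta> by (rule num_inner_eq)
  have sub: "subinterval \<Delta> i = (if i < N then {x i..<x (i + 1)} else {x i..x (i + 1)})"
    if "i \<le> N" for i
    using x(3) \<Delta> that by (rule subinterval_eq)
  obtain P :: "nat \<Rightarrow> real poly" where deg: "\<And>i. i \<le> N \<Longrightarrow> degree (P i) \<le> n"
    and P: "\<And>i t. i \<le> N \<Longrightarrow> t \<in> subinterval \<Delta> i \<Longrightarrow> f t = poly (P i) t"
    using f unfolding spline_space_def num by simp metis
  \<comment> \<open>For n = 0 no smoothness is available, but two constants always differ by a
    multiple of the zeroth power. For n = k + 1, \<open>jump_at_knot\<close> applies on the two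
    subintervals that meet at the knot.\<close>
  have "\<exists>e. P (Suc i) = P i + smult e ([:- x (Suc i), 1:] ^ n)" if i: "i < N" for i
  proof (cases n)
    case 0
    then have "degree (P (Suc i) - P i) = 0"
      using deg[of i] deg[of "Suc i"] i degree_diff_le[of "P (Suc i)" 0 "P i"] by simp
    then obtain e where "P (Suc i) - P i = [:e:]" by (rule degree_eq_zeroE)
    then show ?thesis using 0 by (auto simp: algebra_simps)
  next
    case (Suc k)
    have "C_diff_on k {c..d} f" using f Suc by (auto simp: spline_space_def)
    moreover have "{x i<..<x (Suc (Suc i))} \<subseteq> {c..d}"
      using le[of 0 i] le[of "Suc (Suc i)" "N + 1"] x(1,2) i by auto
    moreover have "f t = poly (P i) t" if "x i < t" "t < x (Suc i)" for t
      using P[of i t] sub[of i] that i by auto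
    moreover have "f t = poly (P (Suc i)) t" if "x (Suc i) < t" "t < x (Suc (Suc i))" for t
      using P[of "Suc i" t] sub[of "Suc i"] that i by auto
    moreover have "x i < x (Suc i)" "x (Suc i) < x (Suc (Suc i))"
      using x(3)[of i] x(3)[of "Suc i"] i by auto
    moreover have "degree (P i) \<le> Suc k" "degree (P (Suc i)) \<le> Suc k"
      using deg[of i] deg[of "Suc i"] i Suc by auto
    ultimately show ?thesis unfolding Suc by (intro jump_at_knot)
  qed
  then obtain e where e: "\<And>i. i < N \<Longrightarrow> P (Suc i) = P i + smult (e i) ([:- x (Suc i), 1:] ^ n)"
    by metis
  have P_eq: "P i = P 0 + (\<Sum>j<i. smult (e j) ([:- x (Suc j), 1:] ^ n))" if "i \<le> N" for i
    using that by (induction i) (auto simp: e)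
  \<comment> \<open>The jump with coefficient \<open>e j\<close> sits at \<open>x (Suc j)\<close>,
    so the inner knots are renumbered from 0.\<close>
  define X where "X j = x (Suc j)" for j
  have inj: "inj_on X {..<N}"
    by (rule inj_onI) (auto simp: X_def dest: inj_onD[OF strict_mono_on_imp_inj_on[OF mono]])
  have inner: "\<Delta> - {c, d} = X ` {..<N}"
  proof -
    have "{0..N + 1} = insert 0 (insert (N + 1) (Suc ` {..<N}))"
      by (auto simp: image_Suc_lessThan)
    then have "\<Delta> = insert c (insert d (X ` {..<N}))"
      unfolding \<Delta> using x(1,2) by (simp add: X_def image_image)
    moreover have "X j \<noteq> c \<and> X j \<noteq> d" if "j < N" for j
      using that strict_mono_onD[OF mono, of 0 "Suc j"] strict_mono_onD[OF mono, of "Suc j" "N + 1"]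
        x(1,2) by (simp add: X_def)
    ultimately show ?thesis by auto
  qed
  \<comment> \<open>Coefficients are attached to points instead of positions, so that different
    partitions can share them.\<close>
  define a where "a \<xi> = e (inv_into {..<N} X \<xi>)" for \<xi>
  have "f t = poly (P 0) t + (\<Sum>\<xi>\<in>\<Delta> - {c, d}. a \<xi> * truncated_power n \<xi> t)"
    if t: "t \<in> {c..d}" for t
  proof -
    \<comment> \<open>The last left end point not exceeding t. The bound N puts t = d into the
      closed last subinterval.\<close>
    define i where "i = (GREATEST i. i \<le> N \<and> x i \<le> t)"
    have i: "i \<le> N \<and> x i \<le> t"
      unfolding i_def by (rule GreatestI_nat[where k = 0 and b = N]) (use t x(1) in auto)
    have max: "j \<le> i" if "j \<le> N" "x j \<le> t" for j
      unfolding i_def by (rule Greatest_le_nat[where b = N]) (use that in auto)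
    have "t < x (i + 1)" if "i < N" using max[of "i + 1"] that by force
    then have "t \<in> subinterval \<Delta> i"
      using i t x(2) sub[of i] by (cases "i < N") auto
    then have "f t = poly (P i) t" using P i by blast
    also have "\<dots> = poly (P 0) t + (\<Sum>j<i. e j * (t - X j) ^ n)"
      using i by (simp add: P_eq[of i] poly_sum X_def algebra_simps)
    \<comment> \<open>For j < i the knot X j is at most x i, hence at most t; for the other j,
      maximality of i gives t < X j and the truncated power vanishes.\<close>
    also have "(\<Sum>j<i. e j * (t - X j) ^ n) = (\<Sum>j<N. e j * truncated_power n (X j) t)"
    proof (rule sum.mono_neutral_cong_left)
      show "\<forall>j\<in>{..<N} - {..<i}. e j * truncated_power n (X j) t = 0"
      proof
        fix j assume "j \<in> {..<N} - {..<i}"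
        then have "t < X j" using max[of "Suc j"] by (force simp: X_def)
        then show "e j * truncated_power n (X j) t = 0" by (simp add: truncated_power_def)
      qed
      show "e j * (t - X j) ^ n = e j * truncated_power n (X j) t" if "j \<in> {..<i}" for j
        using that i le[of "Suc j" i] by (auto simp: truncated_power_def X_def)
    qed (use i in auto)
    also have "\<dots> = (\<Sum>\<xi>\<in>\<Delta> - {c, d}. a \<xi> * truncated_power n \<xi> t)"
      unfolding inner sum.reindex[OF inj] by (simp add: a_def inv_into_f_f[OF inj])
    finally show ?thesis .
  qed
  then show ?thesis using deg[of 0] by auto
qed

text \<open>Smoothness holds term by term, and within one subinterval the same truncated powers are
  switched on throughout, so their sum is a polynomial there.\<close>

lemma truncated_powers_imp_spline:
  assumes part: "is_partition c d \<Delta>" and zero: "\<And>t. t \<notin> {c..d} \<Longrightarrow> f t = 0"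
    and deg: "degree p \<le> n"
    and f: "\<And>t. t \<in> {c..d} \<Longrightarrow>
      f t = poly p t + (\<Sum>\<xi>\<in>\<Delta> - {c, d}. a \<xi> * truncated_power n \<xi> t)"
  shows "f \<in> spline_space (Suc n) c d \<Delta>"
proof -
  obtain N :: nat and x :: "nat \<Rightarrow> real" where x: "x 0 = c" "x (N + 1) = d" "\<And>i. i \<le> N \<Longrightarrow> x i < x (i + 1)"
    and \<Delta>: "\<Delta> = x ` {0..N + 1}"
    using part unfolding is_partition_def by blast
  have mono: "strict_mono_on {0..N + 1} x"
    using strict_mono_on_partition x(3) .
  have le: "x i \<le> x j" if "i \<le> j" "j \<le> N + 1" for i j
    using that strict_mono_on_leD[OF mono, of i j] by simp
  have num: "num_inner \<Delta> = N" using x(3) \<Delta> by (rule num_inner_eq)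
  have sub: "subinterval \<Delta> i = (if i < N then {x i..<x (i + 1)} else {x i..x (i + 1)})"
    if "i \<le> N" for i
    using x(3) \<Delta> that by (rule subinterval_eq)
  have fin: "finite \<Delta>" by (simp add: \<Delta>)
  have "C_diff_on k {c..d} f" if "n = Suc k" for k
  proof (rule C_diff_on_cong)
    show "C_diff_on k {c..d}
        (\<lambda>t. poly p t + (\<Sum>\<xi>\<in>\<Delta> - {c, d}. a \<xi> * truncated_power n \<xi> t))"
      unfolding that by (intro C_diff_on_add C_diff_on_sum C_diff_on_cmult C_diff_on_poly
          C_diff_on_truncated_power)
  qed (use f in auto)
  then have smooth: "Suc n \<ge> 2 \<longrightarrow> C_diff_on (Suc n - 2) {c..d} f" by (cases n) auto
  have "\<exists>q. degree q \<le> n \<and> (\<forall>t\<in>subinterval \<Delta> i. f t = poly q t)" if i: "i \<le> N" for i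
  proof (intro exI conjI ballI)
    \<comment> \<open>The inner knots already passed at the left end point: exactly their powers are
      active on the subinterval.\<close>
    let ?K = "{\<xi> \<in> \<Delta> - {c, d}. \<xi> \<le> x i}"
    let ?q = "p + (\<Sum>\<xi>\<in>?K. smult (a \<xi>) ([:-\<xi>, 1:] ^ n))"
    have "degree (smult (a \<xi>) ([:-\<xi>, 1:] ^ n)) \<le> n" for \<xi>
      by (rule order_trans[OF degree_smult_le]) (simp add: degree_power_eq)
    then show "degree ?q \<le> n"
      using deg fin by (intro degree_add_le degree_sum_le) auto
    fix t assume t: "t \<in> subinterval \<Delta> i"
    then have ti: "x i \<le> t" "t \<le> x (i + 1)" "i < N \<Longrightarrow> t < x (i + 1)"
      using sub[OF i] by (auto split: if_splits)
    then have "t \<in> {c..d}" using le[of 0 i] le[of "i + 1" "N + 1"] x(1,2) i by auto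
    moreover have "(\<Sum>\<xi>\<in>\<Delta> - {c, d}. a \<xi> * truncated_power n \<xi> t) =
        (\<Sum>\<xi>\<in>?K. a \<xi> * (t - \<xi>) ^ n)"
    proof (rule sum.mono_neutral_cong_right)
      show "\<forall>\<xi>\<in>(\<Delta> - {c, d}) - ?K. a \<xi> * truncated_power n \<xi> t = 0"
      proof
        fix \<xi> assume \<xi>: "\<xi> \<in> (\<Delta> - {c, d}) - ?K"
        \<comment> \<open>Since \<xi> is not d, j is at most N. Then i < j gives i < N, so the
          subinterval is half-open and t < \<xi> strictly; for n = 0 this matters, as the step is
          already 1 at its knot.\<close>
        then obtain j where j: "j \<le> N" "\<xi> = x j" using x(2) by (auto simp: \<Delta> le_Suc_eq)
        have "i < j" using \<xi> j i le[of j i] by force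
        then have "t < \<xi>" using j le[of "i + 1" j] ti(3) by force
        then show "a \<xi> * truncated_power n \<xi> t = 0" by (simp add: truncated_power_def)
      qed
      show "a \<xi> * truncated_power n \<xi> t = a \<xi> * (t - \<xi>) ^ n" if "\<xi> \<in> ?K" for \<xi>
        using that ti by (auto simp: truncated_power_def)
    qed (use fin in auto)
    ultimately show "f t = poly ?q t" using f by (simp add: poly_sum)
  qed
  then show ?thesis using zero smooth by (simp add: spline_space_def num)
qed

theorem theorem2:
  fixes c d :: real and m :: nat and \<Delta>\<^sub>1 \<Delta>\<^sub>2 :: "real set"
  assumes "c < d"
    and "m \<ge> 1"
    and "is_partition c d \<Delta>\<^sub>1"
    and "is_partition c d \<Delta>\<^sub>2"
  shows "{(\<lambda>x. f x + g x) | f g. f \<in> spline_space m c d \<Delta>\<^sub>1 \<and> g \<in> spline_space m c d \<Delta>\<^sub>2} =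
         spline_space m c d (\<Delta>\<^sub>1 \<union> \<Delta>\<^sub>2)"
proof -
  obtain n where m: "m = Suc n" using assms(2) by (cases m) auto
  define A B where "A = \<Delta>\<^sub>1 - {c, d}" and "B = \<Delta>\<^sub>2 - {c, d}"
  have AB: "\<Delta>\<^sub>1 \<union> \<Delta>\<^sub>2 - {c, d} = A \<union> B" by (auto simp: A_def B_def)
  have fin: "finite A" "finite B" using assms(3,4) by (auto simp: is_partition_iff A_def B_def)
  have part: "is_partition c d (\<Delta>\<^sub>1 \<union> \<Delta>\<^sub>2)" using assms(3,4) by (rule is_partition_Un)
  let ?T = "truncated_power n"
  \<comment> \<open>Padding with zero coefficients brings sums over A and over B to the common index
    set.\<close>
  have extend: "(\<Sum>\<xi>\<in>C. a \<xi> * ?T \<xi> t) = (\<Sum>\<xi>\<in>A \<union> B. (if \<xi> \<in> C then a \<xi> else 0) * ?T \<xi> t)"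
    if "C \<subseteq> A \<union> B" for C a t
    by (rule sum.mono_neutral_cong_left) (use that fin in auto)
  show ?thesis
  proof (intro equalityI subsetI)
    fix h assume "h \<in> {(\<lambda>x. f x + g x) | f g.
      f \<in> spline_space m c d \<Delta>\<^sub>1 \<and> g \<in> spline_space m c d \<Delta>\<^sub>2}"
    then obtain f g where h: "h = (\<lambda>x. f x + g x)"
      and fg: "f \<in> spline_space (Suc n) c d \<Delta>\<^sub>1" "g \<in> spline_space (Suc n) c d \<Delta>\<^sub>2"
      using m by blast
    obtain p a where p: "degree p \<le> n"
      "\<And>t. t \<in> {c..d} \<Longrightarrow> f t = poly p t + (\<Sum>\<xi>\<in>A. a \<xi> * ?T \<xi> t)"
      using spline_imp_truncated_powers[OF assms(3) fg(1)] unfolding A_def by blast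
    obtain q b where q: "degree q \<le> n"
      "\<And>t. t \<in> {c..d} \<Longrightarrow> g t = poly q t + (\<Sum>\<xi>\<in>B. b \<xi> * ?T \<xi> t)"
      using spline_imp_truncated_powers[OF assms(4) fg(2)] unfolding B_def by blast
    let ?e = "\<lambda>\<xi>. (if \<xi> \<in> A then a \<xi> else 0) + (if \<xi> \<in> B then b \<xi> else 0)"
    have "h \<in> spline_space (Suc n) c d (\<Delta>\<^sub>1 \<union> \<Delta>\<^sub>2)"
    proof (rule truncated_powers_imp_spline[OF part])
      show "h t = 0" if "t \<notin> {c..d}" for t
        using fg that by (simp add: h spline_space_def)
      show "degree (p + q) \<le> n" using p q by (simp add: degree_add_le)
      show "h t = poly (p + q) t + (\<Sum>\<xi>\<in>\<Delta>\<^sub>1 \<union> \<Delta>\<^sub>2 - {c, d}. ?e \<xi> * ?T \<xi> t)"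
        if "t \<in> {c..d}" for t
        using p(2)[OF that] q(2)[OF that] extend[of A a t] extend[of B b t]
        by (simp add: AB h distrib_right sum.distrib)
    qed
    then show "h \<in> spline_space m c d (\<Delta>\<^sub>1 \<union> \<Delta>\<^sub>2)" using m by simp
  next
    fix h assume "h \<in> spline_space m c d (\<Delta>\<^sub>1 \<union> \<Delta>\<^sub>2)"
    then have hs: "h \<in> spline_space (Suc n) c d (\<Delta>\<^sub>1 \<union> \<Delta>\<^sub>2)" using m by simp
    obtain p e where p: "degree p \<le> n"
      "\<And>t. t \<in> {c..d} \<Longrightarrow> h t = poly p t + (\<Sum>\<xi>\<in>A \<union> B. e \<xi> * ?T \<xi> t)"
      using spline_imp_truncated_powers[OF part hs] unfolding AB by blast
    \<comment> \<open>f receives the polynomial and all knots of A. The coefficients b vanish on A,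
      since otherwise knots common to A and B would be counted twice.\<close>
    define f where "f t = (if t \<in> {c..d} then poly p t + (\<Sum>\<xi>\<in>A. e \<xi> * ?T \<xi> t) else 0)" for t
    define b where "b \<xi> = (if \<xi> \<in> A then 0 else e \<xi>)" for \<xi>
    define g where "g t = (if t \<in> {c..d} then \<Sum>\<xi>\<in>B. b \<xi> * ?T \<xi> t else 0)" for t
    have "f \<in> spline_space (Suc n) c d \<Delta>\<^sub>1"
      by (rule truncated_powers_imp_spline[OF assms(3) _ p(1), where a = e])
         (auto simp: f_def A_def)
    moreover have "g \<in> spline_space (Suc n) c d \<Delta>\<^sub>2"
      by (rule truncated_powers_imp_spline[OF assms(4), where a = b and p = 0])
         (auto simp: g_def B_def)
    moreover have "h t = f t + g t" for t
    proof (cases "t \<in> {c..d}")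
      case True
      have "(\<Sum>\<xi>\<in>A \<union> B. e \<xi> * ?T \<xi> t) =
          (\<Sum>\<xi>\<in>A \<union> B. (if \<xi> \<in> A then e \<xi> else 0) * ?T \<xi> t + (if \<xi> \<in> B then b \<xi> else 0) * ?T \<xi> t)"
        by (rule sum.cong) (auto simp: b_def)
      then show ?thesis
        using True p(2)[OF True] extend[of A e t] extend[of B b t]
        by (simp add: f_def g_def sum.distrib)
    next
      case False
      then have "f t = 0" "g t = 0" by (simp_all only: f_def g_def if_False)
      moreover have "h t = 0" using False hs unfolding spline_space_def by blast
      ultimately show ?thesis by simp
    qed
    ultimately show "h \<in> {(\<lambda>x. f x + g x) | f g.
      f \<in> spline_space m c d \<Delta>\<^sub>1 \<and> g \<in> spline_space m c d \<Delta>\<^sub>2}"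
      using m by blast
  qed
qed

end
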